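(* Let $t,f,d$ be integers with $0\le f,d\le t$ and $f\neq d$. Let $k\ge1$ and let $c_1,\dots,c_k$ and $g_1,\dots,g_k$ be integers such that: (i) $\sum_{i=1}^k c_ig_i=t$, with $2\le c_i\le f$ and $1\le g_i\le t/2$ for all $i$; (ii) there is at least one solution vector, i.e. an integer vector $(x_1,\dots,x_k)$ with $0\le x_i\le g_i$ for all $i$ and $\sum_{i=1}^k c_ix_i=f$; (iii) there is no integer vector $(x_1,\dots,x_k)$ with $0\le x_i\le g_i$ for all $i$ and $\sum_{i=1}^k c_ix_i=d$. Suppose moreover that for each $1\le i\le k$ there is at least one solution vector $(x_1,\dots,x_k)$ as in (ii) with $0<x_i<g_i$. Then the following strategy is a successful discreet weighing strategy. Divide the $t$ coins into piles so that for each $i$ there are $c_i$ piles of size $g_i$ (the piles of class $i$), with the same number of fake coins in each of the $c_i$ piles of class $i$, the total number of fake coins being $f$. For each $1\le i\le k$, compare all $c_i$ piles of class $i$ with each other on the balance scale.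
   Context: There are $t$ coins that look identical. Genuine coins all have the same weight $w_1$, and fake coins all have the same weight $w_0<w_1$. A situation is a vector $\mathbf{z}\in\{0,1\}^t$, where $z_i=0$ means that coin $i$ is fake and $z_i=1$ means that it is genuine. For $0\le n\le t$, $Z_n$ is the set of situations with exactly $n$ fake coins. The true situation $\mathbf{x}\in Z_f$ is known to the person weighing, who may therefore choose the piles according to it. An observer knows only that the number of fake coins is $f$ or $d$, and sees the piles, the weighings and their results. A weighing is a nonzero vector $\mathbf{h}\in\{-1,0,1\}^t$ with $\sum_i h_i=0$ ($h_i=-1$: coin $i$ on the left pan; $h_i=1$: right pan; $h_i=0$: not weighed). Its result in situation $\mathbf{z}$ is $s(\mathbf{z},\mathbf{h})=\mathrm{sign}(\mathbf{z}\cdot\mathbf{h})\in\{-1,0,1\}$. A weighing strategy $\mathcal{A}$ of length $m$ is a sequence of consecutive weighings $\mathbf{h}^1,\dots,\mathbf{h}^m$ (possibly with later weighings depending on earlier results). The syndrome of $\mathbf{z}$ is the sequence of results $\mathbf{s}(\mathbf{z}|\mathcal{A})=(s(\mathbf{z},\mathbf{h}^1),\dots,s(\mathbf{z},\mathbf{h}^m))$. For a set $Z$ of situations, $W(\mathbf{s}|Z,\mathcal{A})=\{\mathbf{z}\in Z:\mathbf{s}(\mathbf{z}|\mathcal{A})=\mathbf{s}\}$. Throughout, $\mathbf{s}=\mathbf{s}(\mathbf{x}|\mathcal{A})$ is the syndrome actually observed. $\mathcal{A}$ is successful if $|W(\mathbf{s}|Z_d,\mathcal{A})|=0$ and $|W(\mathbf{s}|Z_f,\mathcal{A})|>0$.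 A successful strategy is discreet if for every $1\le i\le t$ the entry $z_i$ takes both values $0$ and $1$ as $\mathbf{z}$ ranges over $W(\mathbf{s}|Z_f,\mathcal{A})$. *)

theory Defs
  imports Main "HOL-Library.FuncSet" "HOL-Library.Disjoint_Sets"
begin

text \<open>
  Coins are numbered \<open>1, \<dots>, t\<close>. Vectors indexed by the coins are extensional functions on
  \<open>{1..t}\<close>, so that vectors agreeing on all coins are equal and sets of situations are finite.
\<close>

type_synonym coin_vec = "nat \<Rightarrow> int"

text \<open>In a situation, the entry 0 marks a fake coin and 1 a genuine one.\<close>

definition fakes :: "coin_vec \<Rightarrow> nat set \<Rightarrow> nat" where
  "fakes z S = card {i \<in> S. z i = 0}"

definition situations :: "nat \<Rightarrow> nat \<Rightarrow> coin_vec set" where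
  "situations t n = {z \<in> {1..t} \<rightarrow>\<^sub>E {0, 1}. fakes z {1..t} = n}"

definition weighing :: "nat \<Rightarrow> coin_vec \<Rightarrow> bool" where
  "weighing t h \<longleftrightarrow>
     h \<in> {1..t} \<rightarrow>\<^sub>E {-1, 0, 1} \<and> (\<exists>i\<in>{1..t}. h i \<noteq> 0) \<and> (\<Sum>i=1..t. h i) = 0"

definition result :: "nat \<Rightarrow> coin_vec \<Rightarrow> coin_vec \<Rightarrow> int" where
  "result t z h = sgn (\<Sum>i=1..t. z i * h i)"

text \<open>
  An adaptive strategy maps the list of results obtained so far to the next weighing; its length
  \<open>m\<close> is kept as a separate parameter.
\<close>

type_synonym strategy = "int list \<Rightarrow> coin_vec"

definition weighing_strategy :: "nat \<Rightarrow> nat \<Rightarrow> strategy \<Rightarrow> bool" where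
  "weighing_strategy t m A \<longleftrightarrow>
     (\<forall>rs. length rs < m \<and> set rs \<subseteq> {-1, 0, 1} \<longrightarrow> weighing t (A rs))"

primrec syndrome :: "nat \<Rightarrow> strategy \<Rightarrow> nat \<Rightarrow> coin_vec \<Rightarrow> int list" where
  "syndrome t A 0 z = []"
| "syndrome t A (Suc m) z = syndrome t A m z @ [result t z (A (syndrome t A m z))]"

definition consistent ::
  "nat \<Rightarrow> nat \<Rightarrow> strategy \<Rightarrow> int list \<Rightarrow> coin_vec set \<Rightarrow> coin_vec set" where
  "consistent t m A s Z = {z \<in> Z. syndrome t A m z = s}"

text \<open>In the next two definitions \<open>x\<close> is the true situation, which produces the observed syndrome.\<close>

definition successful :: "nat \<Rightarrow> nat \<Rightarrow> nat \<Rightarrow> nat \<Rightarrow> strategy \<Rightarrow> coin_vec \<Rightarrow> bool" where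
  "successful t f d m A x \<longleftrightarrow>
     card (consistent t m A (syndrome t A m x) (situations t d)) = 0 \<and>
     card (consistent t m A (syndrome t A m x) (situations t f)) > 0"

definition discreet :: "nat \<Rightarrow> nat \<Rightarrow> nat \<Rightarrow> nat \<Rightarrow> strategy \<Rightarrow> coin_vec \<Rightarrow> bool" where
  "discreet t f d m A x \<longleftrightarrow>
     successful t f d m A x \<and>
     (\<forall>i\<in>{1..t}. \<forall>b\<in>{0, 1}.
        \<exists>z\<in>consistent t m A (syndrome t A m x) (situations t f). z i = b)"

text \<open>The non-adaptive strategy performing the weighings of a list in order.\<close>

definition fixed_strategy :: "coin_vec list \<Rightarrow> strategy" where
  "fixed_strategy hs = (\<lambda>rs. hs ! length rs)"

definition solution_vector ::
  "nat \<Rightarrow> (nat \<Rightarrow> nat) \<Rightarrow> (nat \<Rightarrow> nat) \<Rightarrow> nat \<Rightarrow> (nat \<Rightarrow> nat) \<Rightarrow> bool" where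
  "solution_vector k c g n y \<longleftrightarrow>
     (\<forall>i\<in>{1..k}. y i \<le> g i) \<and> (\<Sum>i=1..k. c i * y i) = n"

text \<open>
  \<open>P i j\<close> is the \<open>j\<close>-th pile of class \<open>i\<close>. The total number of fake coins is that of the
  situation \<open>x\<close> itself, since the piles contain all the coins.
\<close>

definition pile_division ::
  "nat \<Rightarrow> nat \<Rightarrow> (nat \<Rightarrow> nat) \<Rightarrow> (nat \<Rightarrow> nat) \<Rightarrow> coin_vec \<Rightarrow> (nat \<Rightarrow> nat \<Rightarrow> nat set) \<Rightarrow> bool" where
  "pile_division t k c g x P \<longleftrightarrow>
     disjoint_family_on (\<lambda>(i, j). P i j) (SIGMA i:{1..k}. {1..c i}) \<and>
     (\<Union>i\<in>{1..k}. \<Union>j\<in>{1..c i}. P i j) = {1..t} \<and>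
     (\<forall>i\<in>{1..k}. \<forall>j\<in>{1..c i}. card (P i j) = g i) \<and>
     (\<forall>i\<in>{1..k}. \<forall>j\<in>{1..c i}. \<forall>j'\<in>{1..c i}. fakes x (P i j) = fakes x (P i j'))"

definition weigh_piles :: "nat \<Rightarrow> nat set \<Rightarrow> nat set \<Rightarrow> coin_vec" where
  "weigh_piles t L R = (\<lambda>i\<in>{1..t}. if i \<in> L then -1 else if i \<in> R then 1 else 0)"

text \<open>
  The list \<open>hs\<close> contains only comparisons of two different piles of one class, and any two piles
  of one class are compared; the order of the weighings and the choice of pans are left free.
\<close>

definition class_comparisons ::
  "nat \<Rightarrow> nat \<Rightarrow> (nat \<Rightarrow> nat) \<Rightarrow> (nat \<Rightarrow> nat \<Rightarrow> nat set) \<Rightarrow> coin_vec list \<Rightarrow> bool" where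
  "class_comparisons t k c P hs \<longleftrightarrow>
     (\<forall>h\<in>set hs. \<exists>i\<in>{1..k}. \<exists>j\<in>{1..c i}. \<exists>j'\<in>{1..c i}.
        j \<noteq> j' \<and> h = weigh_piles t (P i j) (P i j')) \<and>
     (\<forall>i\<in>{1..k}. \<forall>j\<in>{1..c i}. \<forall>j'\<in>{1..c i}. j \<noteq> j' \<longrightarrow>
        weigh_piles t (P i j) (P i j') \<in> set hs \<or> weigh_piles t (P i j') (P i j) \<in> set hs)"

end

theory Submission
  imports Defs
begin

text \<open>
  A comparison of two disjoint piles of equal size balances exactly when they contain the same
  number of fake coins (\<open>result_weigh_piles\<close>). In the true situation all comparisons within a
  class balance, so the observed syndrome is constantly 0, and the situations that produce it are
  precisely those in which the number of fake coins in a pile depends only on the class of the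
  pile (\<open>balanced_syndrome_iff\<close>). Such a situation with \<open>n\<close> fake coins yields a solution
  vector for \<open>n\<close>, namely the number of fake coins per pile of each class
  (\<open>solution_vector_of_class_counts\<close>). As \<open>d\<close> has no solution vector, no situation with \<open>d\<close> fake
  coins is consistent with the syndrome, while the true situation shows that \<open>f\<close> fake coins
  remain possible.

  Conversely every solution vector \<open>y\<close> for \<open>f\<close> is realised by declaring any \<open>y i\<close> coins of each
  pile of class \<open>i\<close> to be fake, and all of these situations look alike to the observer. For a coin
  in a pile of class \<open>i\<close>, a solution vector with \<open>0 < y i < g i\<close> leaves room both for choosing
  that coin among the fake ones and for leaving it out (\<open>situation_with_prescribed_coin\<close>); hence
  the strategy is discreet.

  Suitable piles exist because the fake and the genuine coins can be distributed separately, with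
  \<open>y i\<close> of the former and \<open>g i - y i\<close> of the latter going to each pile of class \<open>i\<close>
  (\<open>pile_division_exists\<close>).
\<close>

section \<open>Comparing two piles\<close>

lemma sum_mult_weigh_piles:
  assumes "L \<subseteq> {1..t}" "R \<subseteq> {1..t}" "L \<inter> R = {}"
  shows "(\<Sum>i=1..t. z i * weigh_piles t L R i) = sum z R - sum z L"
proof -
  have "(\<Sum>i=1..t. z i * weigh_piles t L R i)
      = (\<Sum>i=1..t. (if i \<in> R then z i else 0) - (if i \<in> L then z i else 0))"
    using assms(3) by (intro sum.cong) (auto simp: weigh_piles_def)
  also have "\<dots> = sum z ({1..t} \<inter> R) - sum z ({1..t} \<inter> L)"
    by (simp only: sum_subtractf sum.inter_restrict[OF finite_atLeastAtMost])
  also have "\<dots> = sum z R - sum z L"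
    using assms by (simp add: Int_absorb1)
  finally show ?thesis .
qed

lemma sum_eq_card_minus_fakes:
  assumes "finite S" "\<And>i. i \<in> S \<Longrightarrow> z i \<in> {0, 1}"
  shows "sum z S = int (card S) - int (fakes z S)"
proof -
  have "sum z S = (\<Sum>i\<in>S. 1 - (if z i = 0 then 1 else 0))"
    using assms(2) by (intro sum.cong) auto
  also have "\<dots> = int (card S) - int (card (S \<inter> {i. z i = 0}))"
    using assms(1) by (simp add: sum_subtractf sum.If_cases)
  also have "S \<inter> {i. z i = 0} = {i \<in> S. z i = 0}"
    by auto
  finally show ?thesis by (simp add: fakes_def)
qed

lemma result_weigh_piles:
  assumes "L \<subseteq> {1..t}" "R \<subseteq> {1..t}" "L \<inter> R = {}" "card L = card R"
    and "z \<in> {1..t} \<rightarrow>\<^sub>E {0, 1}"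
  shows "result t z (weigh_piles t L R) = sgn (int (fakes z L) - int (fakes z R))"
proof -
  have *: "sum z S = int (card S) - int (fakes z S)" if "S \<subseteq> {1..t}" for S
    using that assms(5)
    by (intro sum_eq_card_minus_fakes) (auto intro: finite_subset dest: PiE_mem)
  show ?thesis
    using assms(4) unfolding result_def sum_mult_weigh_piles[OF assms(1-3)]
    by (simp add: *[OF assms(1)] *[OF assms(2)])
qed

lemma weighing_weigh_piles:
  assumes "L \<subseteq> {1..t}" "R \<subseteq> {1..t}" "L \<inter> R = {}" "card L = card R" "card L \<noteq> 0"
  shows "weighing t (weigh_piles t L R)"
proof -
  obtain a where "a \<in> L" using assms(5) by fastforce
  then have "\<exists>i\<in>{1..t}. weigh_piles t L R i \<noteq> 0"
    using assms(1) by (intro bexI[of _ a]) (auto simp: weigh_piles_def)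
  moreover have "weigh_piles t L R \<in> {1..t} \<rightarrow>\<^sub>E {-1, 0, 1}"
    by (auto simp: weigh_piles_def)
  moreover have "(\<Sum>i=1..t. weigh_piles t L R i) = 0"
    using sum_mult_weigh_piles[OF assms(1-3), of "\<lambda>_. 1"] assms(4) by simp
  ultimately show ?thesis by (simp add: weighing_def)
qed

section \<open>Syndromes of non-adaptive strategies\<close>

lemma syndrome_fixed_strategy_take:
  "m \<le> length hs \<Longrightarrow> syndrome t (fixed_strategy hs) m z = map (result t z) (take m hs)"
  by (induction m) (auto simp: fixed_strategy_def take_Suc_conv_app_nth)

lemma syndrome_fixed_strategy:
  "syndrome t (fixed_strategy hs) (length hs) z = map (result t z) hs"
  by (simp add: syndrome_fixed_strategy_take)

lemma weighing_strategy_fixed_strategy: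
  "(\<And>h. h \<in> set hs \<Longrightarrow> weighing t h) \<Longrightarrow> weighing_strategy t (length hs) (fixed_strategy hs)"
  by (simp add: weighing_strategy_def fixed_strategy_def)

section \<open>Counting fake coins in a pile division\<close>

lemma pile_division_Union:
  "pile_division t k c g x P \<Longrightarrow> (\<Union>i\<in>{1..k}. \<Union>j\<in>{1..c i}. P i j) = {1..t}"
  unfolding pile_division_def by (elim conjE)

lemma pile_division_disjoint_family:
  "pile_division t k c g x P \<Longrightarrow> disjoint_family_on (\<lambda>(i, j). P i j) (SIGMA i:{1..k}. {1..c i})"
  unfolding pile_division_def by (elim conjE)

lemma pile_divisionD:
  assumes "pile_division t k c g x P" "i \<in> {1..k}" "j \<in> {1..c i}"
  shows "P i j \<subseteq> {1..t}"
    and "finite (P i j)"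
    and "card (P i j) = g i"
    and "\<And>j'. j' \<in> {1..c i} \<Longrightarrow> fakes x (P i j) = fakes x (P i j')"
proof -
  show "P i j \<subseteq> {1..t}"
    using pile_division_Union[OF assms(1)] assms(2,3) by blast
  then show "finite (P i j)"
    by (rule finite_subset) simp
  have card: "\<forall>i\<in>{1..k}. \<forall>j\<in>{1..c i}. card (P i j) = g i"
    using assms(1) unfolding pile_division_def by (elim conjE)
  show "card (P i j) = g i"
    by (rule card[rule_format, OF assms(2,3)])
  have eq: "\<forall>i\<in>{1..k}. \<forall>j\<in>{1..c i}. \<forall>j'\<in>{1..c i}. fakes x (P i j) = fakes x (P i j')"
    using assms(1) unfolding pile_division_def by (elim conjE)
  show "fakes x (P i j) = fakes x (P i j')" if "j' \<in> {1..c i}" for j'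
    by (rule eq[rule_format, OF assms(2,3) that])
qed

lemma pile_division_disjoint:
  assumes "pile_division t k c g x P" "i \<in> {1..k}" "j \<in> {1..c i}" "i' \<in> {1..k}" "j' \<in> {1..c i'}"
    and "(i, j) \<noteq> (i', j')"
  shows "P i j \<inter> P i' j' = {}"
  using disjoint_family_onD[OF pile_division_disjoint_family[OF assms(1)], of "(i, j)" "(i', j')"]
    assms(2-6) by simp

lemma fakes_eq_sum_piles:
  assumes "pile_division t k c g x P"
  shows "fakes z {1..t} = (\<Sum>i=1..k. \<Sum>j=1..c i. fakes z (P i j))"
proof -
  define I where "I = (SIGMA i:{1..k}. {1..c i})"
  have "{a \<in> {1..t}. z a = 0} = (\<Union>p\<in>I. {a \<in> P (fst p) (snd p). z a = 0})"
    unfolding pile_division_Union[OF assms, symmetric] I_def by force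
  also have "card \<dots> = (\<Sum>p\<in>I. card {a \<in> P (fst p) (snd p). z a = 0})"
  proof (rule card_UN_disjoint)
    show "finite I" by (simp add: I_def)
    show "\<forall>p\<in>I. finite {a \<in> P (fst p) (snd p). z a = 0}"
      using pile_divisionD(2)[OF assms] by (auto simp: I_def)
    show "\<forall>p\<in>I. \<forall>q\<in>I. p \<noteq> q \<longrightarrow>
        {a \<in> P (fst p) (snd p). z a = 0} \<inter> {a \<in> P (fst q) (snd q). z a = 0} = {}"
    proof (intro ballI impI)
      fix p q assume "p \<in> I" "q \<in> I" "p \<noteq> q"
      then have "P (fst p) (snd p) \<inter> P (fst q) (snd q) = {}"
        by (intro pile_division_disjoint[OF assms]) (auto simp: I_def)
      then show "{a \<in> P (fst p) (snd p). z a = 0} \<inter> {a \<in> P (fst q) (snd q). z a = 0} = {}"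
        by blast
    qed
  qed
  also have "\<dots> = (\<Sum>i=1..k. \<Sum>j=1..c i. fakes z (P i j))"
    unfolding I_def fakes_def by (subst sum.Sigma) (auto simp: case_prod_beta)
  finally show ?thesis by (simp add: fakes_def)
qed

lemma fakes_eq_sum_classes:
  assumes "pile_division t k c g x P"
    and "\<And>i j. i \<in> {1..k} \<Longrightarrow> j \<in> {1..c i} \<Longrightarrow> fakes z (P i j) = y i"
  shows "fakes z {1..t} = (\<Sum>i=1..k. c i * y i)"
  unfolding fakes_eq_sum_piles[OF assms(1)] using assms(2) by (intro sum.cong) auto

text \<open>
  The first pile of a class represents its class, so every class has to contain a pile.
\<close>

lemma solution_vector_of_class_counts:
  assumes P: "pile_division t k c g x P"
    and c: "\<And>i. i \<in> {1..k} \<Longrightarrow> 1 \<le> c i"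
    and eq: "\<And>i j j'. i \<in> {1..k} \<Longrightarrow> j \<in> {1..c i} \<Longrightarrow> j' \<in> {1..c i} \<Longrightarrow>
      fakes z (P i j) = fakes z (P i j')"
  shows "solution_vector k c g (fakes z {1..t}) (\<lambda>i. fakes z (P i 1))"
proof -
  have "fakes z (P i 1) \<le> g i" if i: "i \<in> {1..k}" for i
  proof -
    have "1 \<in> {1..c i}" using c[OF i] by simp
    note D = pile_divisionD[OF P i this]
    have "fakes z (P i 1) \<le> card (P i 1)"
      unfolding fakes_def using D(2) by (intro card_mono) auto
    with D(3) show ?thesis by simp
  qed
  moreover have "fakes z {1..t} = (\<Sum>i=1..k. c i * fakes z (P i 1))"
  proof (rule fakes_eq_sum_classes[OF P])
    fix i j assume "i \<in> {1..k}" "j \<in> {1..c i}"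
    with c[of i] show "fakes z (P i j) = fakes z (P i 1)" by (intro eq) auto
  qed
  ultimately show ?thesis by (simp add: solution_vector_def)
qed

section \<open>The all-balanced syndrome\<close>

lemma class_comparisons_weighing:
  assumes "pile_division t k c g x P" "class_comparisons t k c P hs" "h \<in> set hs"
    and "\<And>i. i \<in> {1..k} \<Longrightarrow> 1 \<le> g i"
  shows "weighing t h"
proof -
  obtain i j j' where ij: "i \<in> {1..k}" "j \<in> {1..c i}" "j' \<in> {1..c i}" "j \<noteq> j'"
    and h: "h = weigh_piles t (P i j) (P i j')"
    using assms(2,3) unfolding class_comparisons_def by blast
  show ?thesis unfolding h
    using pile_divisionD(1,3)[OF assms(1) ij(1,2)] pile_divisionD(1,3)[OF assms(1) ij(1,3)]
      pile_division_disjoint[OF assms(1) ij(1,2) ij(1,3)] ij(4) assms(4)[OF ij(1)]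
    by (intro weighing_weigh_piles) auto
qed

lemma result_class_comparison:
  assumes "pile_division t k c g x P" "z \<in> {1..t} \<rightarrow>\<^sub>E {0, 1}"
    and "i \<in> {1..k}" "j \<in> {1..c i}" "j' \<in> {1..c i}" "j \<noteq> j'"
  shows "result t z (weigh_piles t (P i j) (P i j')) = 0 \<longleftrightarrow> fakes z (P i j) = fakes z (P i j')"
  using pile_divisionD(1,3)[OF assms(1,3,4)] pile_divisionD(1,3)[OF assms(1,3,5)]
    pile_division_disjoint[OF assms(1,3,4,3,5)] assms(2,6)
  by (subst result_weigh_piles) (auto simp: sgn_0_0)

lemma balanced_syndrome_iff:
  assumes P: "pile_division t k c g x P" and hs: "class_comparisons t k c P hs"
    and z: "z \<in> {1..t} \<rightarrow>\<^sub>E {0, 1}"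
  shows "map (result t z) hs = map (\<lambda>_. 0) hs \<longleftrightarrow>
    (\<forall>i\<in>{1..k}. \<forall>j\<in>{1..c i}. \<forall>j'\<in>{1..c i}. fakes z (P i j) = fakes z (P i j'))"
    (is "?balanced \<longleftrightarrow> ?equal")
proof
  assume bal: ?balanced
  show ?equal
  proof (intro ballI)
    fix i j j' assume ij: "i \<in> {1..k}" "j \<in> {1..c i}" "j' \<in> {1..c i}"
    show "fakes z (P i j) = fakes z (P i j')"
    proof (cases "j = j'")
      case False
      then have "weigh_piles t (P i j) (P i j') \<in> set hs \<or> weigh_piles t (P i j') (P i j) \<in> set hs"
        using hs ij unfolding class_comparisons_def by blast
      then have "result t z (weigh_piles t (P i j) (P i j')) = 0 \<or>
          result t z (weigh_piles t (P i j') (P i j)) = 0"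
        using bal by auto
      then show ?thesis
        using result_class_comparison[OF P z] ij False by metis
    qed simp
  qed
next
  assume eq: ?equal
  show ?balanced
  proof (rule map_cong[OF refl])
    fix h assume "h \<in> set hs"
    then obtain i j j' where ij: "i \<in> {1..k}" "j \<in> {1..c i}" "j' \<in> {1..c i}" "j \<noteq> j'"
      and h: "h = weigh_piles t (P i j) (P i j')"
      using hs unfolding class_comparisons_def by blast
    show "result t z h = 0"
      unfolding h result_class_comparison[OF P z ij] using eq ij by blast
  qed
qed

lemma finite_situations: "finite (situations t n)"
  unfolding situations_def
  by (rule finite_subset[of _ "{1..t} \<rightarrow>\<^sub>E {0, 1}"]) (auto intro: finite_PiE)

text \<open>
  In the true situation every comparison balances, which makes the set of situations left to the
  observer independent of the list of comparisons.
\<close>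

lemma consistent_class_comparisons:
  assumes P: "pile_division t k c g x P" and hs: "class_comparisons t k c P hs"
    and x: "x \<in> situations t f"
  shows "consistent t (length hs) (fixed_strategy hs)
      (syndrome t (fixed_strategy hs) (length hs) x) (situations t n)
    = {z \<in> situations t n.
        \<forall>i\<in>{1..k}. \<forall>j\<in>{1..c i}. \<forall>j'\<in>{1..c i}. fakes z (P i j) = fakes z (P i j')}"
proof -
  have "x \<in> {1..t} \<rightarrow>\<^sub>E {0, 1}" using x by (simp add: situations_def)
  note balanced_x = balanced_syndrome_iff[OF P hs this]
  have x0: "map (result t x) hs = map (\<lambda>_. 0) hs"
    unfolding balanced_x by (intro ballI pile_divisionD(4)[OF P])
  show ?thesis
    unfolding consistent_def syndrome_fixed_strategy x0
    by (intro Collect_cong conj_cong refl balanced_syndrome_iff[OF P hs])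
      (simp add: situations_def)
qed

section \<open>Realising solution vectors\<close>

lemma exists_subset_prescribed_element:
  assumes "finite A" "a \<in> A" "0 < n" "n < card A"
  shows "\<exists>S\<subseteq>A. card S = n \<and> (a \<in> S \<longleftrightarrow> b)"
proof (cases b)
  case True
  have "n - 1 \<le> card (A - {a})" using assms by simp
  then obtain S where S: "S \<subseteq> A - {a}" "card S = n - 1" "finite S"
    by (rule obtain_subset_with_card_n)
  then have "a \<notin> S" by blast
  with S assms have "insert a S \<subseteq> A" "card (insert a S) = n" by auto
  with True show ?thesis by blast
next
  case False
  have "n \<le> card (A - {a})" using assms by simp
  then obtain S where "S \<subseteq> A - {a}" "card S = n" "finite S"
    by (rule obtain_subset_with_card_n)
  with False show ?thesis by blast
qed

text \<open>
  The fake coins are chosen separately in each pile; only in the pile of the given coin is the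
  choice constrained, and the strict bounds on its class are what makes either value possible.
\<close>

lemma situation_with_prescribed_coin:
  assumes P: "pile_division t k c g x P"
    and y: "solution_vector k c g n y"
    and ij: "i0 \<in> {1..k}" "j0 \<in> {1..c i0}" and a: "a \<in> P i0 j0"
    and strict: "0 < y i0" "y i0 < g i0"
    and b: "b \<in> {0, 1}"
  shows "\<exists>z\<in>situations t n. z a = b \<and>
    (\<forall>i\<in>{1..k}. \<forall>j\<in>{1..c i}. fakes z (P i j) = y i)"
proof -
  have "\<exists>S\<subseteq>P i j. card S = y i \<and> (a \<in> P i j \<longrightarrow> (a \<in> S \<longleftrightarrow> b = 0))"
    if "i \<in> {1..k}" "j \<in> {1..c i}" for i j
  proof (cases "a \<in> P i j")
    case True
    then have "i = i0" using pile_division_disjoint[OF P that ij] a by auto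
    with True strict pile_divisionD(2,3)[OF P that] show ?thesis
      using exists_subset_prescribed_element[of "P i j" a "y i" "b = 0"] by auto
  next
    case False
    have "y i \<le> card (P i j)"
      using y that pile_divisionD(3)[OF P that] by (simp add: solution_vector_def)
    then obtain S where "S \<subseteq> P i j" "card S = y i" "finite S"
      by (rule obtain_subset_with_card_n)
    with False show ?thesis by blast
  qed
  then obtain S where S: "\<And>i j. i \<in> {1..k} \<Longrightarrow> j \<in> {1..c i} \<Longrightarrow>
      S i j \<subseteq> P i j \<and> card (S i j) = y i \<and> (a \<in> P i j \<longrightarrow> (a \<in> S i j \<longleftrightarrow> b = 0))"
    by metis
  define F where "F = (\<Union>i\<in>{1..k}. \<Union>j\<in>{1..c i}. S i j)"
  define z :: coin_vec where "z = (\<lambda>e\<in>{1..t}. if e \<in> F then 0 else 1)"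
  have F_pile: "P i j \<inter> F = S i j" if "i \<in> {1..k}" "j \<in> {1..c i}" for i j
  proof
    show "S i j \<subseteq> P i j \<inter> F" using S[OF that] that unfolding F_def by blast
    show "P i j \<inter> F \<subseteq> S i j"
    proof
      fix e assume e: "e \<in> P i j \<inter> F"
      then obtain i' j' where ij': "i' \<in> {1..k}" "j' \<in> {1..c i'}" "e \<in> S i' j'"
        unfolding F_def by blast
      then have "e \<in> P i' j'" using S by blast
      with e have "(i, j) = (i', j')"
        using pile_division_disjoint[OF P that ij'(1,2)] by blast
      with ij'(3) show "e \<in> S i j" by simp
    qed
  qed
  have fakes_z: "fakes z (P i j) = y i" if "i \<in> {1..k}" "j \<in> {1..c i}" for i j
  proof -
    have "{e \<in> P i j. z e = 0} = P i j \<inter> F"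
      using pile_divisionD(1)[OF P that] by (auto simp: z_def)
    then show ?thesis using F_pile[OF that] S[OF that] by (simp add: fakes_def)
  qed
  have "fakes z {1..t} = n"
    using fakes_eq_sum_classes[OF P fakes_z] y by (simp add: solution_vector_def)
  then have "z \<in> situations t n" by (auto simp: situations_def z_def)
  moreover have "z a = b"
  proof -
    have "a \<in> {1..t}" using pile_divisionD(1)[OF P ij] a by blast
    moreover have "a \<in> F \<longleftrightarrow> b = 0" using F_pile[OF ij] S[OF ij] a by blast
    ultimately show ?thesis using b by (auto simp: z_def)
  qed
  ultimately show ?thesis using fakes_z by blast
qed

section \<open>Existence of the piles and of the comparisons\<close>

lemma exists_partition_with_cards:
  assumes "finite I" "finite A" "card A = (\<Sum>i\<in>I. n i)"
  shows "\<exists>B. disjoint_family_on B I \<and> (\<Union>i\<in>I. B i) = A \<and> (\<forall>i\<in>I. card (B i) = n i)"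
  using assms
proof (induction I arbitrary: A rule: finite_induct)
  case empty
  then show ?case by (simp add: disjoint_family_on_def)
next
  case (insert p I)
  then have "n p \<le> card A" by simp
  then obtain S where S: "S \<subseteq> A" "card S = n p" "finite S"
    by (rule obtain_subset_with_card_n)
  have "card (A - S) = (\<Sum>i\<in>I. n i)"
    using insert.hyps insert.prems S by (simp add: card_Diff_subset)
  with insert.IH[of "A - S"] insert.prems(1) obtain B
    where B: "disjoint_family_on B I" "(\<Union>i\<in>I. B i) = A - S" "\<forall>i\<in>I. card (B i) = n i"
    by auto
  let ?B = "B(p := S)"
  have upd: "?B i = B i" if "i \<in> I" for i using that insert.hyps by auto
  then have un: "(\<Union>i\<in>I. ?B i) = A - S" using B(2) by auto
  have "disjoint_family_on ?B I"
    using B(1) upd by (simp add: disjoint_family_on_def)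
  then have "disjoint_family_on ?B (insert p I)"
    using un insert.hyps by (subst disjoint_family_on_insert) auto
  moreover have "(\<Union>i\<in>insert p I. ?B i) = A"
    unfolding UN_insert un using S(1) by auto
  moreover have "\<forall>i\<in>insert p I. card (?B i) = n i" using B(3) S(2) upd by auto
  ultimately show ?case by blast
qed

lemma pile_division_exists:
  assumes x: "x \<in> situations t f" and t: "(\<Sum>i=1..k. c i * g i) = t"
    and y: "solution_vector k c g f y"
  shows "\<exists>P. pile_division t k c g x P"
proof -
  define I where "I = (SIGMA i:{1..k}. {1..c i})"
  define F where "F = {a \<in> {1..t}. x a = 0}"
  have fin: "finite I" "finite F" by (auto simp: I_def F_def)
  have F_sub: "F \<subseteq> {1..t}" by (auto simp: F_def)
  have sum_I: "(\<Sum>p\<in>I. n (fst p)) = (\<Sum>i=1..k. c i * n i)" for n :: "nat \<Rightarrow> nat"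
    unfolding I_def using sum.Sigma[of "{1..k}" "\<lambda>i. {1..c i}" "\<lambda>i j. n i"]
    by (simp add: case_prod_beta)
  have yle: "y i \<le> g i" if "i \<in> {1..k}" for i
    using y that by (simp add: solution_vector_def)
  have card_F: "card F = (\<Sum>i=1..k. c i * y i)"
    using x y by (simp add: F_def situations_def fakes_def solution_vector_def)
  then have "card F = (\<Sum>p\<in>I. y (fst p))" by (simp add: sum_I)
  from exists_partition_with_cards[OF fin this] obtain B where B: "disjoint_family_on B I"
    "(\<Union>p\<in>I. B p) = F" "\<forall>p\<in>I. card (B p) = y (fst p)" by (elim exE conjE)
  have "(\<Sum>i=1..k. c i * (g i - y i)) = (\<Sum>i=1..k. c i * g i) - (\<Sum>i=1..k. c i * y i)"
    using yle by (subst sum_subtractf_nat[symmetric]) (auto simp: diff_mult_distrib2)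
  also have "\<dots> = card ({1..t} - F)"
    using F_sub fin card_F t by (simp add: card_Diff_subset)
  finally have "card ({1..t} - F) = (\<Sum>p\<in>I. g (fst p) - y (fst p))"
    using sum_I[of "\<lambda>i. g i - y i"] by simp
  from exists_partition_with_cards[OF fin(1) _ this] obtain C where
    C: "disjoint_family_on C I" "(\<Union>p\<in>I. C p) = {1..t} - F"
    "\<forall>p\<in>I. card (C p) = g (fst p) - y (fst p)" by auto
  define P where "P i j = B (i, j) \<union> C (i, j)" for i j
  have sub: "B p \<subseteq> F" "C p \<subseteq> {1..t} - F" if "p \<in> I" for p
    using that B(2) C(2) by blast+
  have fakes_P: "fakes x (P i j) = y i" if "i \<in> {1..k}" "j \<in> {1..c i}" for i j
  proof -
    have p: "(i, j) \<in> I" using that by (simp add: I_def)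
    have "{a \<in> P i j. x a = 0} = B (i, j)"
      using sub[OF p] by (auto simp: P_def F_def)
    then show ?thesis using B(3) p by (auto simp: fakes_def)
  qed
  have card_P: "card (P i j) = g i" if "i \<in> {1..k}" "j \<in> {1..c i}" for i j
  proof -
    have p: "(i, j) \<in> I" using that by (simp add: I_def)
    have "finite (B (i, j))" using sub(1)[OF p] fin(2) by (rule finite_subset)
    moreover have "finite (C (i, j))" using sub(2)[OF p] by (rule finite_subset) simp
    moreover have "B (i, j) \<inter> C (i, j) = {}" using sub[OF p] by blast
    ultimately have "card (P i j) = card (B (i, j)) + card (C (i, j))"
      unfolding P_def by (rule card_Un_disjoint)
    then show ?thesis using B(3) C(3) p yle[OF that(1)] by auto
  qed
  have "disjoint_family_on (\<lambda>(i, j). P i j) I"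
    unfolding disjoint_family_on_def
  proof (intro ballI impI)
    fix p q assume pq: "p \<in> I" "q \<in> I" "p \<noteq> q"
    have "B p \<inter> B q = {}" "C p \<inter> C q = {}"
      using disjoint_family_onD[OF B(1) pq] disjoint_family_onD[OF C(1) pq] by auto
    moreover have "B p \<inter> C q = {}" "C p \<inter> B q = {}"
      using sub[OF pq(1)] sub[OF pq(2)] by blast+
    ultimately show "(case p of (i, j) \<Rightarrow> P i j) \<inter> (case q of (i, j) \<Rightarrow> P i j) = {}"
      by (auto simp: P_def split: prod.splits)
  qed
  moreover have "(\<Union>i\<in>{1..k}. \<Union>j\<in>{1..c i}. P i j) = {1..t}"
  proof -
    have "(\<Union>i\<in>{1..k}. \<Union>j\<in>{1..c i}. P i j) = (\<Union>p\<in>I. B p) \<union> (\<Union>p\<in>I. C p)"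
      by (auto simp: I_def P_def)
    then show ?thesis using B(2) C(2) F_sub by auto
  qed
  ultimately have "pile_division t k c g x P"
    using fakes_P card_P by (simp add: pile_division_def I_def)
  then show ?thesis by blast
qed

lemma class_comparisons_exists: "\<exists>hs. class_comparisons t k c P hs"
proof -
  define H where "H = (\<Union>i\<in>{1..k}. \<Union>j\<in>{1..c i}.
    (\<lambda>j'. weigh_piles t (P i j) (P i j')) ` ({1..c i} - {j}))"
  have "finite H"
    unfolding H_def by (intro finite_UN_I finite_imageI finite_Diff finite_atLeastAtMost)
  obtain hs where hs: "set hs = H" using finite_list[OF \<open>finite H\<close>] by blast
  have "class_comparisons t k c P hs"
    unfolding class_comparisons_def hs
  proof (intro conjI ballI impI)
    fix h assume "h \<in> H"
    then obtain i j j' where ij: "i \<in> {1..k}" "j \<in> {1..c i}" "j' \<in> {1..c i} - {j}"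
      and h: "h = weigh_piles t (P i j) (P i j')"
      unfolding H_def by (elim UN_E imageE) (rule that)
    from ij(3) have "j' \<in> {1..c i}" "j \<noteq> j'" by auto
    with ij(1,2) h show "\<exists>i\<in>{1..k}. \<exists>j\<in>{1..c i}. \<exists>j'\<in>{1..c i}.
        j \<noteq> j' \<and> h = weigh_piles t (P i j) (P i j')"
      by (intro bexI[of _ i] bexI[of _ j] bexI[of _ j'] conjI)
  next
    fix i j j' assume "i \<in> {1..k}" "j \<in> {1..c i}" "j' \<in> {1..c i}" "j \<noteq> j'"
    then have "weigh_piles t (P i j) (P i j') \<in> H"
      unfolding H_def by blast
    then show "weigh_piles t (P i j) (P i j') \<in> H \<or> weigh_piles t (P i j') (P i j) \<in> H" ..
  qed
  then show ?thesis by blast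
qed

section \<open>The strategy is successful and discreet\<close>

theorem theorem6:
  fixes t f d k :: nat and c g :: "nat \<Rightarrow> nat" and x :: coin_vec
  assumes "f \<le> t" and "d \<le> t" and "f \<noteq> d" and "1 \<le> k"
    and "(\<Sum>i=1..k. c i * g i) = t"
    and "\<forall>i\<in>{1..k}. 2 \<le> c i \<and> c i \<le> f"
    and "\<forall>i\<in>{1..k}. 1 \<le> g i \<and> 2 * g i \<le> t"
    and "\<exists>y. solution_vector k c g f y"
    and "\<not> (\<exists>y. solution_vector k c g d y)"
    and "\<forall>i\<in>{1..k}. \<exists>y. solution_vector k c g f y \<and> 0 < y i \<and> y i < g i"
    and "x \<in> situations t f"
  shows "(\<exists>P hs. pile_division t k c g x P \<and> class_comparisons t k c P hs) \<and>
         (\<forall>P hs. pile_division t k c g x P \<and> class_comparisons t k c P hs \<longrightarrow>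
            weighing_strategy t (length hs) (fixed_strategy hs) \<and>
            successful t f d (length hs) (fixed_strategy hs) x \<and>
            discreet t f d (length hs) (fixed_strategy hs) x)"
proof (intro conjI allI impI; (elim conjE)?)
  show "\<exists>P hs. pile_division t k c g x P \<and> class_comparisons t k c P hs"
    using pile_division_exists assms(5,8,11) class_comparisons_exists by metis
next
  fix P hs assume P: "pile_division t k c g x P" and hs: "class_comparisons t k c P hs"
  show "weighing_strategy t (length hs) (fixed_strategy hs)"
    using class_comparisons_weighing[OF P hs] assms(7)
    by (intro weighing_strategy_fixed_strategy) blast
  let ?W = "\<lambda>n. consistent t (length hs) (fixed_strategy hs)
    (syndrome t (fixed_strategy hs) (length hs) x) (situations t n)"
  note W = consistent_class_comparisons[OF P hs assms(11)]
  have "?W d = {}"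
  proof (rule equals0I)
    fix z assume z: "z \<in> ?W d"
    have "solution_vector k c g (fakes z {1..t}) (\<lambda>i. fakes z (P i 1))"
    proof (rule solution_vector_of_class_counts[OF P])
      show "1 \<le> c i" if "i \<in> {1..k}" for i using assms(6) that by force
    qed (use z W in blast)
    moreover have "fakes z {1..t} = d" using z W by (simp add: situations_def)
    ultimately show False using assms(9) by blast
  qed
  moreover have "x \<in> ?W f" by (simp add: consistent_def assms(11))
  moreover have "finite (?W f)"
    using finite_situations by (simp add: consistent_def)
  ultimately show succ: "successful t f d (length hs) (fixed_strategy hs) x"
    unfolding successful_def by (auto simp: card_gt_0_iff)
  have "\<exists>z\<in>?W f. z a = b" if a: "a \<in> {1..t}" and b: "b \<in> {0, 1}" for a b
  proof -
    obtain i j where ij: "i \<in> {1..k}" "j \<in> {1..c i}" "a \<in> P i j"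
      using pile_division_Union[OF P] a by blast
    obtain y where "solution_vector k c g f y" "0 < y i" "y i < g i"
      using assms(10) ij(1) by blast
    from situation_with_prescribed_coin[OF P this(1) ij this(2,3) b]
    obtain z where "z \<in> situations t f" "z a = b"
      "\<forall>i\<in>{1..k}. \<forall>j\<in>{1..c i}. fakes z (P i j) = y i" by blast
    then show ?thesis unfolding W by (intro bexI[of _ z]) simp_all
  qed
  with succ show "discreet t f d (length hs) (fixed_strategy hs) x"
    unfolding discreet_def by blast
qed

end
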